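(* The icosahedral graph (the 1-skeleton of the regular icosahedron, a 5-regular graph on 12 vertices) is diagonal.
   Context: $d$ denotes the shortest-path distance. For vertices $x_0,\dots,x_k$ put $\ell(x_0,\dots,x_k)=\sum_{i=0}^{k-1}d(x_i,x_{i+1})$. The magnitude chain complex: $\mathrm{MC}_{k,l}(G)$ is the free abelian group on $I_{k,l}(G)=\{(x_0,\dots,x_k)\in V(G)^{k+1}: x_i\neq x_{i+1}\ \forall i,\ \ell(x_0,\dots,x_k)=l\}$, with differential $\partial=\sum_{i=1}^{k-1}(-1)^i\partial_i:\mathrm{MC}_{k,l}\to\mathrm{MC}_{k-1,l}$, where $\partial_i(x_0,\dots,x_k)=(x_0,\dots,\hat x_i,\dots,x_k)$ if deleting $x_i$ does not change $\ell$, and $0$ otherwise. Magnitude homology: $\mathrm{MH}_{k,l}(G)=H_k(\mathrm{MC}_{*,l}(G))$. $G$ is diagonal if $\mathrm{MH}_{k,l}(G)=0$ whenever $k\ne l$. *)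

theory Defs
  imports Main "HOL-Library.Extended_Nat"
begin

text \<open>A finite simple graph is given by a vertex set V and a symmetric,
irreflexive adjacency relation E.  Vertex tuples (x_0,...,x_k) are lists of
length k+1.\<close>

definition is_walk :: "('a \<Rightarrow> 'a \<Rightarrow> bool) \<Rightarrow> 'a set \<Rightarrow> 'a list \<Rightarrow> bool" where
  "is_walk E V p \<longleftrightarrow> p \<noteq> [] \<and> set p \<subseteq> V \<and> (\<forall>i. Suc i < length p \<longrightarrow> E (p ! i) (p ! Suc i))"

text \<open>Shortest-path distance (infinite if no path exists).\<close>
definition gdist :: "'a set \<Rightarrow> ('a \<Rightarrow> 'a \<Rightarrow> bool) \<Rightarrow> 'a \<Rightarrow> 'a \<Rightarrow> enat" where
  "gdist V E x y = Inf {enat (length p - 1) | p. is_walk E V p \<and> hd p = x \<and> last p = y}"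

definition tlen :: "'a set \<Rightarrow> ('a \<Rightarrow> 'a \<Rightarrow> bool) \<Rightarrow> 'a list \<Rightarrow> enat" where
  "tlen V E xs = (\<Sum>i<length xs - 1. gdist V E (xs ! i) (xs ! Suc i))"

definition gens :: "'a set \<Rightarrow> ('a \<Rightarrow> 'a \<Rightarrow> bool) \<Rightarrow> nat \<Rightarrow> nat \<Rightarrow> 'a list set" where
  "gens V E k l = {xs. length xs = Suc k \<and> set xs \<subseteq> V
      \<and> (\<forall>i. Suc i < length xs \<longrightarrow> xs ! i \<noteq> xs ! Suc i) \<and> tlen V E xs = enat l}"

definition del_at :: "nat \<Rightarrow> 'a list \<Rightarrow> 'a list" where
  "del_at i xs = take i xs @ drop (Suc i) xs"

text \<open>Chains in MC_{k,l}(G): integer combinations of generators, represented as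
integer-valued functions on tuples supported in I_{k,l}(G).\<close>
definition is_chain :: "'a set \<Rightarrow> ('a \<Rightarrow> 'a \<Rightarrow> bool) \<Rightarrow> nat \<Rightarrow> nat \<Rightarrow> ('a list \<Rightarrow> int) \<Rightarrow> bool" where
  "is_chain V E k l c \<longleftrightarrow> (\<forall>xs. xs \<notin> gens V E k l \<longrightarrow> c xs = 0)"

text \<open>The differential MC_{k,l} \<rightarrow> MC_{k-1,l}: the linear extension of
sum_{i=1}^{k-1} (-1)^i \<partial>_i, where \<partial>_i deletes x_i if this keeps the length, else 0.\<close>
definition mbd :: "'a set \<Rightarrow> ('a \<Rightarrow> 'a \<Rightarrow> bool) \<Rightarrow> nat \<Rightarrow> nat \<Rightarrow> ('a list \<Rightarrow> int) \<Rightarrow> ('a list \<Rightarrow> int)" where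
  "mbd V E k l c = (\<lambda>ys. \<Sum>xs\<in>gens V E k l. c xs *
      (\<Sum>i\<in>{1..k-1}. if tlen V E (del_at i xs) = tlen V E xs \<and> del_at i xs = ys
                      then (-1) ^ i else 0))"

definition MH_vanishes :: "'a set \<Rightarrow> ('a \<Rightarrow> 'a \<Rightarrow> bool) \<Rightarrow> nat \<Rightarrow> nat \<Rightarrow> bool" where
  "MH_vanishes V E k l \<longleftrightarrow>
     (\<forall>c. is_chain V E k l c \<and> mbd V E k l c = (\<lambda>_. 0) \<longrightarrow>
        (\<exists>b. is_chain V E (Suc k) l b \<and> mbd V E (Suc k) l b = c))"

definition diagonal :: "'a set \<Rightarrow> ('a \<Rightarrow> 'a \<Rightarrow> bool) \<Rightarrow> bool" where
  "diagonal V E \<longleftrightarrow> (\<forall>k l. k \<noteq> l \<longrightarrow> MH_vanishes V E k l)"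

text \<open>The icosahedral graph: vertex 0 (top), upper pentagon 1..5, lower pentagon 6..10,
vertex 11 (bottom); the two pentagons joined as an antiprism.\<close>
definition ico_V :: "nat set" where "ico_V = {0..11}"

definition ico_edge_list :: "(nat \<times> nat) list" where
  "ico_edge_list =
    [(0,1),(0,2),(0,3),(0,4),(0,5),
     (1,2),(2,3),(3,4),(4,5),(5,1),
     (6,7),(7,8),(8,9),(9,10),(10,6),
     (1,6),(1,7),(2,7),(2,8),(3,8),(3,9),(4,9),(4,10),(5,10),(5,6),
     (11,6),(11,7),(11,8),(11,9),(11,10)]"

definition ico_E :: "nat \<Rightarrow> nat \<Rightarrow> bool" where
  "ico_E x y \<longleftrightarrow> (x, y) \<in> set ico_edge_list \<or> (y, x) \<in> set ico_edge_list"

end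

theory Submission
  imports Defs
begin

text \<open>
  The pairs of vertices span an algebra whose product of \<open>(x, y)\<close> and \<open>(y, z)\<close> is \<open>(x, z)\<close> if
  \<open>y\<close> lies on a geodesic from \<open>x\<close> to \<open>z\<close>, and zero otherwise; the magnitude complex is its bar
  complex, and diagonality means that the algebra is Koszul. This holds because there is a Koszul
  filtration: at a vertex \<open>x\<close> take the right ideals generated by the arcs of the pentagon of
  neighbours of \<open>x\<close>. If an arc grows by a vertex \<open>s\<close>, the colon ideal of the new generator is
  generated by an arc of 3, 4 or 5 neighbours of \<open>s\<close>. Since the rotation group of the icosahedron
  acts transitively on the vertices, this is only verified at one vertex.
\<close>

section \<open>Chains with a fixed starting point\<close>

locale finite_distance =
  fixes V :: "'a set" and d :: "'a \<Rightarrow> 'a \<Rightarrow> nat"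
  assumes finite_V: "finite V"
    and d_eq_0_iff: "d x y = 0 \<longleftrightarrow> x = y"
    and d_triangle: "d x z \<le> d x y + d y z"
begin

text \<open>In a nondegenerate tuple these are the vertices that can be deleted between
  \<open>a\<close> and \<open>b\<close> without changing the length.\<close>

definition btw :: "'a \<Rightarrow> 'a \<Rightarrow> 'a set" where
  "btw a b = {v \<in> V. v \<noteq> a \<and> v \<noteq> b \<and> d a v + d v b = d a b}"

fun adm :: "'a \<Rightarrow> 'a list \<Rightarrow> bool" where
  "adm a [] \<longleftrightarrow> True"
| "adm a (b # r) \<longleftrightarrow> b \<in> V \<and> b \<noteq> a \<and> adm b r"

fun plen :: "'a \<Rightarrow> 'a list \<Rightarrow> nat" where
  "plen a [] = 0"
| "plen a (b # r) = d a b + plen b r"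

text \<open>A chain all of whose tuples start at the vertex \<open>a\<close> is a function of the remaining
  entries; splitting off the deletion of the first of them makes the differential recursive.\<close>
fun bdry :: "'a \<Rightarrow> ('a list \<Rightarrow> int) \<Rightarrow> 'a list \<Rightarrow> int" where
  "bdry a c [] = 0"
| "bdry a c (b # r) = - (\<Sum>v\<in>btw a b. c (v # b # r)) - bdry b (\<lambda>t. c (b # t)) r"

section \<open>Linearity of the boundary\<close>

lemma finite_btw [simp]: "finite (btw a b)"
  using finite_V by (simp add: btw_def)

lemma bdry_zero [simp]: "bdry a (\<lambda>_. 0) r = 0"
  by (induction r arbitrary: a) auto

lemma bdry_add: "bdry a (\<lambda>t. f t + g t) r = bdry a f r + bdry a g r"
  by (induction r arbitrary: a f g) (auto simp: sum.distrib)

lemma bdry_uminus: "bdry a (\<lambda>t. - f t) r = - bdry a f r"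
  by (induction r arbitrary: a f) (auto simp: sum_negf)

lemma bdry_diff: "bdry a (\<lambda>t. f t - g t) r = bdry a f r - bdry a g r"
  using bdry_add[of a f "\<lambda>t. - g t"] by (simp add: bdry_uminus)

lemma bdry_sum:
  assumes "finite A"
  shows "bdry a (\<lambda>t. \<Sum>v\<in>A. f v t) r = (\<Sum>v\<in>A. bdry a (f v) r)"
  using assms by (induction A rule: finite_induct) (auto simp: bdry_add)

text \<open>Both sides say that \<open>a\<close>, \<open>w\<close>, \<open>v\<close>,
  \<open>b\<close> are successive points of one geodesic: by the triangle inequality each amounts to
  \<open>d a w + d w v + d v b = d a b\<close> with consecutive points distinct.\<close>

lemma btw_swap:
  "v \<in> btw a b \<and> w \<in> btw a v \<longleftrightarrow> w \<in> btw a b \<and> v \<in> btw w b"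
proof
  assume *: "v \<in> btw a b \<and> w \<in> btw a v"
  then have "w \<noteq> b"
    using d_eq_0_iff[of w v] d_eq_0_iff[of w b] d_triangle[of a b w] by (auto simp: btw_def)
  then show "w \<in> btw a b \<and> v \<in> btw w b"
    using * d_triangle[of a b w] d_triangle[of w b v] by (auto simp: btw_def)
next
  assume *: "w \<in> btw a b \<and> v \<in> btw w b"
  then have "v \<noteq> a"
    using d_eq_0_iff[of w v] d_eq_0_iff[of a w] d_eq_0_iff[of v v] d_triangle[of a b v]
    by (auto simp: btw_def)
  then show "v \<in> btw a b \<and> w \<in> btw a v"
    using * d_triangle[of a b v] d_triangle[of a v w] by (auto simp: btw_def)
qed

text \<open>Consider the two vertices inserted into \<open>b # r\<close>. If both precede
  \<open>b\<close>, the two orders of insertion cancel by \<open>btw_swap\<close>; if only one does,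
  the two terms have opposite signs; if none does, the induction hypothesis applies.\<close>

lemma bdry_bdry: "bdry a (bdry a c) r = 0"
proof (induction r arbitrary: a c)
  case (Cons b r)
  have swap: "(\<Sum>v\<in>btw a b. \<Sum>w\<in>btw a v. c (w # v # b # r))
      = (\<Sum>v\<in>btw a b. \<Sum>w\<in>btw v b. c (v # w # b # r))"
  proof -
    have "(\<Sum>v\<in>btw a b. \<Sum>w\<in>btw a v. c (w # v # b # r))
        = (\<Sum>(v, w)\<in>Sigma (btw a b) (btw a). c (w # v # b # r))"
      by (subst sum.Sigma) auto
    also have "\<dots> = (\<Sum>(w, v)\<in>Sigma (btw a b) (\<lambda>w. btw w b). c (w # v # b # r))"
      by (rule sum.reindex_bij_witness[of _ prod.swap prod.swap])
        (auto, (use btw_swap in blast)+)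
    also have "\<dots> = (\<Sum>v\<in>btw a b. \<Sum>w\<in>btw v b. c (v # w # b # r))"
      by (subst sum.Sigma) auto
    finally show ?thesis .
  qed
  have "bdry b (\<lambda>t. bdry a c (b # t)) r = - (\<Sum>v\<in>btw a b. bdry b (\<lambda>t. c (v # b # t)) r)"
    using Cons.IH[of b "\<lambda>t. c (b # t)"] by (simp add: bdry_diff bdry_uminus bdry_sum)
  then show ?case
    using swap by (simp add: sum_subtractf sum.distrib sum_negf)
qed simp

text \<open>A tuple in the support of the boundary arises by a deletion from one in the support of
  \<open>c\<close>. If the first entry was deleted, it lies between \<open>a\<close> and the new
  first entry; this makes ideals stable under the boundary.\<close>

lemma bdry_nonzeroE:
  assumes "bdry a c r \<noteq> 0"
  obtains r' where "c r' \<noteq> 0" "length r' = Suc (length r)" "plen a r' = plen a r"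
    "adm a r' \<Longrightarrow> adm a r" "r \<noteq> []" "hd r = hd r' \<or> hd r' \<in> btw a (hd r)"
proof -
  have "\<exists>r'. c r' \<noteq> 0 \<and> length r' = Suc (length r) \<and> plen a r' = plen a r \<and>
    (adm a r' \<longrightarrow> adm a r) \<and> r \<noteq> [] \<and> (hd r = hd r' \<or> hd r' \<in> btw a (hd r))"
    using assms
  proof (induction r arbitrary: a c)
    case (Cons b r)
    then consider v where "v \<in> btw a b" "c (v # b # r) \<noteq> 0" | "bdry b (\<lambda>t. c (b # t)) r \<noteq> 0"
      using sum.neutral[of "btw a b" "\<lambda>v. c (v # b # r)"] by fastforce
    then show ?case
    proof cases
      case 1
      then have "b \<noteq> a"
        using d_eq_0_iff[of a v] d_eq_0_iff[of a a] by (auto simp: btw_def)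
      with 1 show ?thesis
        by (intro exI[of _ "v # b # r"]) (auto simp: btw_def)
    next
      case 2
      then obtain r' where "c (b # r') \<noteq> 0" "length r' = Suc (length r)" "plen b r' = plen b r"
        "adm b r' \<longrightarrow> adm b r"
        using Cons.IH[of b "\<lambda>t. c (b # t)"] by blast
      then show ?thesis
        by (intro exI[of _ "b # r'"]) auto
    qed
  qed simp
  then show ?thesis
    using that by blast
qed

section \<open>Koszul filtrations\<close>

text \<open>For \<open>x\<close> outside \<open>U\<close>, the pairs \<open>(x, y)\<close> with
  \<open>y\<close> in \<open>U\<close> span a right ideal.\<close>

definition closed_from :: "'a \<Rightarrow> 'a set \<Rightarrow> bool" where
  "closed_from x U \<longleftrightarrow> (\<forall>y\<in>U. \<forall>z\<in>V. y \<in> btw x z \<longrightarrow> z \<in> U)"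

text \<open>The bar complex of the right ideal \<open>U\<close>. Its homology is a Tor of the ideal,
  so exactness for \<open>k \<noteq> l\<close> means that the ideal has a linear resolution. Degree
  0 is zero because of \<open>r \<noteq> []\<close>.\<close>

definition chain_in :: "'a \<Rightarrow> 'a set \<Rightarrow> nat \<Rightarrow> nat \<Rightarrow> ('a list \<Rightarrow> int) \<Rightarrow> bool" where
  "chain_in x U k l c \<longleftrightarrow>
     (\<forall>r. c r \<noteq> 0 \<longrightarrow> adm x r \<and> length r = k \<and> plen x r = l \<and> r \<noteq> [] \<and> hd r \<in> U)"

lemma chain_in_add: "chain_in x U k l f \<Longrightarrow> chain_in x U k l g \<Longrightarrow> chain_in x U k l (\<lambda>t. f t + g t)"
  unfolding chain_in_def by (metis add_0)

lemma chain_in_diff: "chain_in x U k l f \<Longrightarrow> chain_in x U k l g \<Longrightarrow> chain_in x U k l (\<lambda>t. f t - g t)"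
  unfolding chain_in_def by (metis diff_0_right)

lemma chain_in_mono: "chain_in x U k l f \<Longrightarrow> U \<subseteq> U' \<Longrightarrow> chain_in x U' k l f"
  unfolding chain_in_def by blast

lemma chain_in_bdry:
  assumes "chain_in x U (Suc k) l c" "closed_from x U"
  shows "chain_in x U k l (bdry x c)"
  unfolding chain_in_def
proof (intro allI impI)
  fix r assume "bdry x c r \<noteq> 0"
  then obtain r' where r': "c r' \<noteq> 0" "length r' = Suc (length r)" "plen x r' = plen x r"
    "adm x r' \<Longrightarrow> adm x r" "r \<noteq> []" "hd r = hd r' \<or> hd r' \<in> btw x (hd r)"
    by (rule bdry_nonzeroE) blast
  then have "adm x r'" "hd r' \<in> U" "length r' = Suc k" "plen x r' = l"
    using assms(1) by (auto simp: chain_in_def)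
  moreover from this r' have "hd r \<in> V"
    by (cases r) auto
  ultimately show "adm x r \<and> length r = k \<and> plen x r = l \<and> r \<noteq> [] \<and> hd r \<in> U"
    using r' assms(2) by (auto simp: closed_from_def)
qed

text \<open>\<open>U\<close> arises from \<open>U'\<close> by adding the generator
  \<open>(x, s)\<close>. The last set is the colon ideal: for \<open>z\<close> in it, the product of
  \<open>(x, s)\<close> and \<open>(s, z)\<close> is zero or lies in \<open>U'\<close>.\<close>

definition koszul_filtration :: "('a \<Rightarrow> 'a set \<Rightarrow> bool) \<Rightarrow> bool" where
  "koszul_filtration F \<longleftrightarrow> (\<forall>x U. F x U \<longrightarrow> U \<subseteq> V \<and> closed_from x U \<and>
     (U = {} \<or> (\<exists>s U'. F x U' \<and> U' \<subseteq> U \<and> s \<in> U - U' \<and> d x s = 1 \<and>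
        (\<forall>y\<in>U - U'. d x s + d s y = d x y) \<and> F s (V - {s} - (U - U')))))"

lemma koszul_filtrationD:
  assumes "koszul_filtration F" "F x U"
  shows "U \<subseteq> V" "closed_from x U"
  using assms unfolding koszul_filtration_def by simp_all

lemma koszul_filtrationE:
  assumes "koszul_filtration F" "F x U" "U \<noteq> {}"
  obtains s U' where "F x U'" "U' \<subseteq> U" "s \<in> U - U'" "d x s = 1"
    "\<And>y. y \<in> U - U' \<Longrightarrow> d x s + d s y = d x y" "F s (V - {s} - (U - U'))"
proof -
  have "U = {} \<or> (\<exists>s U'. F x U' \<and> U' \<subseteq> U \<and> s \<in> U - U' \<and> d x s = 1 \<and>
        (\<forall>y\<in>U - U'. d x s + d s y = d x y) \<and> F s (V - {s} - (U - U')))"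
    using assms(1,2) unfolding koszul_filtration_def by simp
  with assms(3) that show ?thesis
    by (elim disjE exE conjE) auto
qed

text \<open>Induction on the degree, and within it on the size of \<open>U\<close>. The quotient of
  \<open>U\<close> by \<open>U'\<close> is generated by \<open>s\<close> with the colon ideal as its
  relations, so the outer hypothesis, with degree and length both lowered by 1, moves the cycle into
  \<open>U'\<close>.\<close>

theorem exact_off_diagonal:
  assumes F: "koszul_filtration F" and "F x U" "k \<noteq> l" "chain_in x U k l c" "\<And>r. bdry x c r = 0"
  shows "\<exists>b. chain_in x U (Suc k) l b \<and> bdry x b = c"
  using assms(2-)
proof (induction k arbitrary: x U l c)
  case 0
  then have "c = (\<lambda>_. 0)"
    by (force simp: chain_in_def)
  then show ?case
    by (intro exI[of _ "\<lambda>_. 0"]) (auto simp: chain_in_def)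
next
  case (Suc m)
  note outer = Suc.IH
  have finU: "finite U"
    using koszul_filtrationD(1)[OF F Suc.prems(1)] finite_V by (rule finite_subset)
  show ?case
    using Suc.prems finU
  proof (induction "card U" arbitrary: U c rule: less_induct)
    case less
    note c = \<open>chain_in x U (Suc m) l c\<close>
    show ?case
    proof (cases "U = {}")
      case True
      then have "c = (\<lambda>_. 0)"
        using c by (force simp: chain_in_def)
      then show ?thesis
        by (intro exI[of _ "\<lambda>_. 0"]) (auto simp: chain_in_def)
    next
      case False
      have UV: "U \<subseteq> V" and clU: "closed_from x U"
        using koszul_filtrationD[OF F less.prems(1)] by auto
      obtain s U' where FU': "F x U'" and U'U: "U' \<subseteq> U" and s: "s \<in> U - U'" "d x s = 1"
        and out: "\<And>y. y \<in> U - U' \<Longrightarrow> d x s + d s y = d x y"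
        and FK: "F s (V - {s} - (U - U'))"
        by (rule koszul_filtrationE[OF F less.prems(1) False]) (rule that)
      have clU': "closed_from x U'"
        using koszul_filtrationD(2)[OF F FU'] .
      define W where "W = U - U' - {s}"
      have sV: "s \<in> V" and sx: "s \<noteq> x"
        using s UV d_eq_0_iff[of x x] by auto
      have sW: "s \<in> btw x y" if "y \<in> W" for y
        using that out[of y] sV sx by (auto simp: btw_def W_def)
      have btw_s: "btw x s = {}"
      proof -
        have False if "v \<in> btw x s" for v
          using that s(2) d_eq_0_iff[of x v] d_eq_0_iff[of v s] by (auto simp: btw_def)
        then show ?thesis by blast
      qed

      txt \<open>Adding \<open>\<partial>h\<close> removes the tuples with second entry in \<open>W\<close>, since \<open>s\<close> lies between \<open>x\<close> and \<open>W\<close>.\<close>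
      define h where "h = (\<lambda>r. if \<exists>z t. r = s # z # t \<and> z \<in> W then c (tl r) else 0)"
      have h_s: "h (s # z # t) = (if z \<in> W then c (z # t) else 0)" for z t
        by (auto simp: h_def)
      have h_other: "h (v # t) = 0" if "v \<noteq> s" for v t
        using that by (auto simp: h_def)
      have h: "chain_in x U (Suc (Suc m)) l h"
        unfolding chain_in_def
      proof (intro allI impI)
        fix r assume "h r \<noteq> 0"
        then obtain z t where r: "r = s # z # t" "z \<in> W" "c (z # t) \<noteq> 0"
          by (auto simp: h_def split: if_splits)
        then have "adm x (z # t)" "length (z # t) = Suc m" "plen x (z # t) = l"
          using c by (auto simp: chain_in_def)
        then show "adm x r \<and> length r = Suc (Suc m) \<and> plen x r = l \<and> r \<noteq> [] \<and> hd r \<in> U"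
          using r s sV sx sW[of z] by (auto simp: btw_def)
      qed

      define c1 where "c1 = (\<lambda>r. c r + bdry x h r)"
      have c1: "chain_in x U (Suc m) l c1"
        unfolding c1_def by (intro chain_in_add c chain_in_bdry h clU)
      have bdry_c1: "bdry x c1 r = 0" for r
        using less.prems(4) bdry_bdry[of x h] by (simp add: c1_def bdry_add)
      \<comment> \<open>Of the vertices inserted before \<open>z\<close>, only \<open>s\<close> is
        seen by \<open>h\<close>. Its sign is negative, so the boundary of \<open>h\<close>
        contributes exactly \<open>- c (z # t)\<close>.\<close>
      have c1_W: "c1 (z # t) = 0" if "z \<in> W" for z t
      proof -
        have "(\<Sum>v\<in>btw x z. h (v # z # t)) = (\<Sum>v\<in>{s}. h (v # z # t))"
          using sW[OF that] by (intro sum.mono_neutral_right) (auto intro: h_other)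
        moreover have "z \<noteq> s"
          using that by (auto simp: W_def)
        ultimately show ?thesis
          using that by (simp add: c1_def h_s h_other)
      qed
      have c1_hd: "v = s \<or> v \<in> U'" if "c1 (v # t) \<noteq> 0" for v t
        using that c1 c1_W[of v t] by (fastforce simp: chain_in_def W_def)

      txt \<open>The tuples of \<open>c1\<close> with second entry \<open>s\<close> form a cycle \<open>e\<close> over the colon ideal at \<open>s\<close>.\<close>
      define e where "e = (\<lambda>t. c1 (s # t))"
      \<comment> \<open>Compare coefficients of the cycle \<open>c1\<close> at \<open>z # t\<close>:
        an inserted vertex from \<open>U'\<close> would force \<open>z\<close> into
        \<open>U'\<close>, and the remaining terms vanish by \<open>c1_W\<close>, so only
        \<open>c1 (s # z # t)\<close> is left.\<close>
      have e_W: "e (z # t) = 0" if "z \<in> W" for z t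
      proof -
        have zero: "c1 (v # z # t) = 0" if v: "v \<in> btw x z - {s}" for v
        proof (rule ccontr)
          assume "c1 (v # z # t) \<noteq> 0"
          then have "v \<in> U'"
            using c1_hd v by blast
          then have "z \<in> U'"
            using clU' v \<open>z \<in> W\<close> UV by (auto simp: closed_from_def W_def)
          then show False
            using \<open>z \<in> W\<close> by (auto simp: W_def)
        qed
        have "(\<Sum>v\<in>btw x z. c1 (v # z # t)) = (\<Sum>v\<in>{s}. c1 (v # z # t))"
          using sW[OF that] zero by (intro sum.mono_neutral_right) auto
        moreover have "bdry x c1 (z # t) = 0"
          by (rule bdry_c1)
        ultimately show ?thesis
          using that by (simp add: c1_W e_def)
      qed
      have bdry_e: "bdry s e t = 0" for t
        using bdry_c1[of "s # t"] by (simp add: btw_s e_def)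
      have e: "chain_in s (V - {s} - (U - U')) m (l - 1) e \<and> (e \<noteq> (\<lambda>_. 0) \<longrightarrow> l \<ge> 1)"
      proof -
        have "adm s t \<and> length t = m \<and> plen s t = l - 1 \<and> t \<noteq> [] \<and> hd t \<in> V - {s} - (U - U') \<and> l \<ge> 1"
          if "e t \<noteq> 0" for t
        proof -
          have *: "adm s t" "length t = m" "1 + plen s t = l"
            using that c1 s(2) by (auto simp: e_def chain_in_def)
          \<comment> \<open>An empty \<open>t\<close> would mean \<open>m = 0\<close> and
            \<open>l = 1\<close>, which is on the diagonal.\<close>
          moreover have "t \<noteq> []"
            using * \<open>Suc m \<noteq> l\<close> by auto
          moreover from this obtain z t' where "t = z # t'"
            by (cases t) auto
          ultimately show ?thesis
            using e_W[of z t'] that by (auto simp: W_def)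
        qed
        then show ?thesis
          by (auto simp: chain_in_def)
      qed
      \<comment> \<open>The case \<open>e = 0\<close> is treated apart because \<open>l - 1\<close>
        is truncated: for \<open>m = 0\<close> and \<open>l = 0\<close> it would equal
        \<open>m\<close>, and the induction hypothesis would not apply.\<close>
      obtain f where f: "chain_in s (V - {s} - (U - U')) (Suc m) (l - 1) f" "bdry s f = e"
        and l: "f \<noteq> (\<lambda>_. 0) \<longrightarrow> l \<ge> 1"
      proof (cases "e = (\<lambda>_. 0)")
        case True
        then show ?thesis
          by (intro that[of "\<lambda>_. 0"]) (auto simp: chain_in_def)
      next
        case False
        then have "l \<ge> 1" "m \<noteq> l - 1"
          using e \<open>Suc m \<noteq> l\<close> by auto
        then show ?thesis
          using outer[OF FK _ _ bdry_e] e that by blast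
      qed

      \<comment> \<open>Prefixing \<open>s\<close> shifts all positions by one and reverses the sign
        of the boundary, hence the minus sign.\<close>
      define g where "g = (\<lambda>r. if r \<noteq> [] \<and> hd r = s then - f (tl r) else 0)"
      have g: "chain_in x U (Suc (Suc m)) l g"
        unfolding chain_in_def
      proof (intro allI impI)
        fix r assume "g r \<noteq> 0"
        then obtain t where r: "r = s # t" "f t \<noteq> 0"
          by (cases r) (auto simp: g_def split: if_splits)
        then have "l \<ge> 1"
          using l by auto
        moreover have "adm s t" "length t = Suc m" "plen s t = l - 1"
          using r f(1) by (auto simp: chain_in_def)
        ultimately show "adm x r \<and> length r = Suc (Suc m) \<and> plen x r = l \<and> r \<noteq> [] \<and> hd r \<in> U"
          using r s sV sx by auto
      qed

      define c2 where "c2 = (\<lambda>r. c1 r - bdry x g r)"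
      have c2_U: "chain_in x U (Suc m) l c2"
        unfolding c2_def by (intro chain_in_diff c1 chain_in_bdry g clU)
      \<comment> \<open>At \<open>z = s\<close> the boundary of \<open>g\<close> equals
        \<open>e\<close>. At the other \<open>z\<close> in \<open>U - U'\<close> both terms of
        \<open>c2\<close> vanish, since \<open>f\<close> is supported over the colon ideal.\<close>
      have c2_hd: "z \<in> U'" if nz: "c2 (z # t) \<noteq> 0" for z t
      proof (rule ccontr)
        assume z: "z \<notin> U'"
        have zU: "z \<in> U"
          using c2_U nz by (fastforce simp: chain_in_def)
        show False
        proof (cases "z = s")
          case True
          then have "bdry x g (z # t) = e t"
            by (simp add: btw_s g_def bdry_uminus f(2))
          then show False
            using nz True by (simp add: c2_def e_def)
        next
          case False
          then have "f (z # t) = 0"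
            using f(1) z zU by (fastforce simp: chain_in_def)
          then have "bdry x g (z # t) = 0"
            using False by (simp add: g_def sum.neutral)
          moreover have "c1 (z # t) = 0"
            using c1_W z zU False by (auto simp: W_def)
          ultimately show False
            using nz by (simp add: c2_def)
        qed
      qed
      have c2: "chain_in x U' (Suc m) l c2"
        unfolding chain_in_def
      proof (intro allI impI)
        fix r assume "c2 r \<noteq> 0"
        then show "adm x r \<and> length r = Suc m \<and> plen x r = l \<and> r \<noteq> [] \<and> hd r \<in> U'"
          using c2_U c2_hd[of "hd r" "tl r"] by (auto simp: chain_in_def)
      qed
      have bdry_c2: "bdry x c2 r = 0" for r
        using bdry_c1 bdry_bdry[of x g] by (simp add: c2_def bdry_diff)
      have "card U' < card U"
        using U'U s less.prems(5) by (intro psubset_card_mono) auto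
      moreover have "finite U'"
        using U'U less.prems(5) by (rule finite_subset)
      ultimately obtain b where b: "chain_in x U' (Suc (Suc m)) l b" "bdry x b = c2"
        using less.hyps[OF _ FU' \<open>Suc m \<noteq> l\<close> c2 bdry_c2] by blast
      show ?thesis
      \<comment> \<open>By construction \<open>c\<close> is \<open>c2\<close> plus the boundary of
        \<open>g\<close> minus the boundary of \<open>h\<close>.\<close>
      proof (intro exI[of _ "\<lambda>r. (b r + g r) - h r"] conjI)
        show "chain_in x U (Suc (Suc m)) l (\<lambda>r. (b r + g r) - h r)"
          by (intro chain_in_add chain_in_diff g h chain_in_mono[OF b(1) U'U])
        show "bdry x (\<lambda>r. (b r + g r) - h r) = c"
          by (simp add: fun_eq_iff bdry_add bdry_diff b(2) c2_def c1_def)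
      qed
    qed
  qed
qed

section \<open>Isometries and translated filtrations\<close>

definition isometry :: "('a \<Rightarrow> 'a) \<Rightarrow> bool" where
  "isometry f \<longleftrightarrow> f ` V = V \<and> (\<forall>x\<in>V. \<forall>y\<in>V. d (f x) (f y) = d x y)"

lemma isometry_id: "isometry id"
  by (simp add: isometry_def)

lemma isometry_comp: "isometry f \<Longrightarrow> isometry g \<Longrightarrow> isometry (f \<circ> g)"
  unfolding isometry_def by (metis comp_apply image_comp image_eqI)

lemma isometry_inj_on: "isometry f \<Longrightarrow> inj_on f V"
  unfolding isometry_def inj_on_def by (metis d_eq_0_iff)

lemma isometry_image_Diff:
  "isometry f \<Longrightarrow> A \<subseteq> V \<Longrightarrow> B \<subseteq> V \<Longrightarrow> f ` (A - B) = f ` A - f ` B"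
  using inj_on_image_set_diff[OF isometry_inj_on] by blast

lemma isometry_btw_iff:
  assumes "isometry f" "x \<in> V" "y \<in> V" "z \<in> V"
  shows "f y \<in> btw (f x) (f z) \<longleftrightarrow> y \<in> btw x z"
proof -
  have "f y = f x \<longleftrightarrow> y = x" "f y = f z \<longleftrightarrow> y = z"
    using isometry_inj_on[OF assms(1)] assms by (auto dest: inj_onD)
  moreover have "f y \<in> V"
    using assms by (auto simp: isometry_def)
  ultimately show ?thesis
    using assms by (simp add: btw_def isometry_def)
qed

text \<open>By homogeneity a Koszul filtration only has to be given at one vertex, provided that the
  colon ideals that arise are translates of its members.\<close>
lemma koszul_filtration_translates:
  fixes S :: "nat \<Rightarrow> 'a set"
  assumes p: "p \<in> V" and S_0: "S 0 = {}"
    and S: "\<And>j. j \<le> n \<Longrightarrow> S j \<subseteq> V \<and> closed_from p (S j)"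
    and step: "\<And>j. j < n \<Longrightarrow> \<exists>f m. isometry f \<and> m \<le> n \<and> S j \<subseteq> S (Suc j) \<and>
      f p \<in> S (Suc j) - S j \<and> d p (f p) = 1 \<and>
      (\<forall>y\<in>S (Suc j) - S j. d p (f p) + d (f p) y = d p y) \<and>
      V - {f p} - (S (Suc j) - S j) = f ` S m"
  shows "koszul_filtration (\<lambda>x U. \<exists>g j. isometry g \<and> j \<le> n \<and> x = g p \<and> U = g ` S j)"
    (is "koszul_filtration ?F")
  unfolding koszul_filtration_def
proof (intro allI impI)
  fix x U assume "?F x U"
  then obtain g j where g: "isometry g" and j: "j \<le> n" and x: "x = g p" and U: "U = g ` S j"
    by blast
  have gV: "g ` V = V" and g_d: "\<And>x y. x \<in> V \<Longrightarrow> y \<in> V \<Longrightarrow> d (g x) (g y) = d x y"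
    using g by (auto simp: isometry_def)
  have "U \<subseteq> V"
    using S[OF j] gV U by blast
  moreover have "closed_from x U"
    unfolding closed_from_def
  proof (intro ballI impI)
    fix y z assume y: "y \<in> U" and z: "z \<in> V" and btw: "y \<in> btw x z"
    obtain y' where y': "y' \<in> S j" "y = g y'"
      using y U by blast
    obtain z' where z': "z' \<in> V" "z = g z'"
      using z gV by blast
    have "y' \<in> btw p z'"
      using isometry_btw_iff[OF g p _ z'(1), of y'] btw x y' z' S[OF j] by blast
    then show "z \<in> U"
      using S[OF j] y' z' U by (auto simp: closed_from_def)
  qed
  moreover have "U = {} \<or> (\<exists>s U'. ?F x U' \<and> U' \<subseteq> U \<and> s \<in> U - U' \<and> d x s = 1 \<and>
      (\<forall>y\<in>U - U'. d x s + d s y = d x y) \<and> ?F s (V - {s} - (U - U')))"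
  proof (cases j)
    case 0
    then show ?thesis
      by (simp add: U S_0)
  next
    \<comment> \<open>The step from \<open>S i\<close> to \<open>S j\<close> is carried along by
      \<open>g\<close>: the new generator is \<open>g (f p)\<close>, and its colon ideal is the
      translate of \<open>S m\<close> by \<open>g \<circ> f\<close>.\<close>
    case (Suc i)
    then have "i < n"
      using j by simp
    then obtain f m where f: "isometry f" "m \<le> n" and sub: "S i \<subseteq> S j"
      and s: "f p \<in> S j - S i" "d p (f p) = 1"
      and out: "\<forall>y\<in>S j - S i. d p (f p) + d (f p) y = d p y"
      and K: "V - {f p} - (S j - S i) = f ` S m"
      using step[of i] Suc by blast
    have SV: "S i \<subseteq> V" "S j \<subseteq> V"
      using S \<open>i < n\<close> j by auto
    have diff: "U - g ` S i = g ` (S j - S i)"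
      using isometry_image_Diff[OF g SV(2,1)] U by simp
    have "?F x (g ` S i)"
      using g \<open>i < n\<close> x by (intro exI[of _ g] exI[of _ i]) auto
    moreover have "g (f p) \<in> U - g ` S i"
      using s diff by auto
    moreover have "d x (g (f p)) = 1"
      using s SV p x g_d by auto
    moreover have "d x (g (f p)) + d (g (f p)) y = d x y" if "y \<in> U - g ` S i" for y
      using that out s SV p x g_d unfolding diff by (auto simp: subset_iff)
    moreover have "V - {g (f p)} - (U - g ` S i) = (g \<circ> f) ` S m"
    proof -
      have "g ` (V - {f p} - (S j - S i)) = g ` (V - {f p}) - g ` (S j - S i)"
        using SV by (intro isometry_image_Diff[OF g]) auto
      also have "g ` (V - {f p}) = V - {g (f p)}"
        using isometry_image_Diff[OF g, of V "{f p}"] gV s SV by auto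
      finally show ?thesis
        by (simp add: diff K image_comp)
    qed
    then have "?F (g (f p)) (V - {g (f p)} - (U - g ` S i))"
      using isometry_comp[OF g f(1)] f(2) by (intro exI[of _ "g \<circ> f"] exI[of _ m]) simp
    ultimately show ?thesis
      using sub U by (intro disjI2 exI[of _ "g (f p)"] exI[of _ "g ` S i"]) blast
  qed
  ultimately show "U \<subseteq> V \<and> closed_from x U \<and> (U = {} \<or> (\<exists>s U'. ?F x U' \<and> U' \<subseteq> U \<and>
      s \<in> U - U' \<and> d x s = 1 \<and> (\<forall>y\<in>U - U'. d x s + d s y = d x y) \<and>
      ?F s (V - {s} - (U - U'))))"
    by (intro conjI)
qed

section \<open>Comparison with the magnitude complex\<close>

text \<open>Unrolls the recursion. Index \<open>i\<close> of \<open>r\<close> is position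
  \<open>Suc i\<close> of the whole tuple, which gives the exponent; the inserted \<open>v\<close>
  stands between \<open>(a # r) ! i\<close> and \<open>r ! i\<close>.\<close>

lemma bdry_eq_sum:
  "bdry a c r = (\<Sum>i<length r. (-1) ^ Suc i *
     (\<Sum>v\<in>btw ((a # r) ! i) (r ! i). c (take i r @ v # drop i r)))"
proof (induction r arbitrary: a c)
  case (Cons b r)
  then show ?case
    by (simp add: sum.lessThan_Suc_shift sum_negf del: sum.lessThan_Suc)
qed simp

lemma plen_insert:
  assumes "i < length r"
  shows "plen x (take i r @ v # drop i r) + d ((x # r) ! i) (r ! i)
    = plen x r + d ((x # r) ! i) v + d v (r ! i)"
  using assms
proof (induction r arbitrary: x i)
  case (Cons b r)
  then show ?case
    by (cases i) auto
qed simp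

lemma adm_insertD:
  assumes "adm x (take i r @ v # drop i r)" "i < length r"
  shows "v \<in> V \<and> v \<noteq> (x # r) ! i \<and> v \<noteq> r ! i"
  using assms
proof (induction r arbitrary: x i)
  case (Cons b r)
  then show ?case
    by (cases i) auto
qed simp

lemma adm_iff:
  "adm x r \<longleftrightarrow> set r \<subseteq> V \<and> (\<forall>i. Suc i < length (x # r) \<longrightarrow> (x # r) ! i \<noteq> (x # r) ! Suc i)"
proof (induction r arbitrary: x)
  case (Cons b r)
  show ?case
    by (auto simp: Cons.IH[of b] nth_Cons split: nat.splits)
qed simp

context
  fixes E :: "'a \<Rightarrow> 'a \<Rightarrow> bool"
  assumes gdist_eq: "\<And>x y. x \<in> V \<Longrightarrow> y \<in> V \<Longrightarrow> gdist V E x y = enat (d x y)"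
begin

lemma tlen_eq: "x \<in> V \<Longrightarrow> set r \<subseteq> V \<Longrightarrow> tlen V E (x # r) = enat (plen x r)"
proof (induction r arbitrary: x)
  case Nil
  then show ?case by (simp add: tlen_def zero_enat_def)
next
  case (Cons b r)
  have "tlen V E (x # b # r) = gdist V E x b + tlen V E (b # r)"
    by (simp add: tlen_def sum.lessThan_Suc_shift del: sum.lessThan_Suc)
  then show ?case
    using Cons by (simp add: gdist_eq)
qed

lemma Cons_in_gens:
  "x # r \<in> gens V E k l \<longleftrightarrow> x \<in> V \<and> adm x r \<and> length r = k \<and> plen x r = l"
  using tlen_eq[of x r] by (auto simp: gens_def adm_iff)

lemma Nil_notin_gens: "[] \<notin> gens V E k l"
  by (simp add: gens_def)

lemma finite_gens: "finite (gens V E k l)"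
  by (rule finite_subset[OF _ finite_lists_length_eq[OF finite_V, of "Suc k"]])
    (auto simp: gens_def)

text \<open>Deletion is inverted by inserting a vertex \<open>v\<close>. By
  \<open>plen_insert\<close>, equality of lengths is equality in the triangle inequality at
  \<open>v\<close>; nondegeneracy of \<open>xs\<close> separates \<open>v\<close> from its
  neighbours.\<close>

lemma del_at_eq_iff:
  assumes xs: "xs \<in> gens V E k l" and r: "k = Suc (length r)" "i < length r"
  shows "tlen V E (del_at (Suc i) xs) = tlen V E xs \<and> del_at (Suc i) xs = x # r \<longleftrightarrow>
    xs \<in> (\<lambda>v. x # take i r @ v # drop i r) ` btw ((x # r) ! i) (r ! i)"
proof -
  have iff: "tlen V E (x # r) = tlen V E xs \<longleftrightarrow> v \<in> btw ((x # r) ! i) (r ! i)"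
    if v: "xs = x # take i r @ v # drop i r" for v
  proof -
    have *: "x \<in> V" "adm x (take i r @ v # drop i r)"
      using xs by (auto simp: v Cons_in_gens)
    then have sub: "set (take i r @ v # drop i r) \<subseteq> V"
      by (auto simp: adm_iff)
    then have "set r \<subseteq> V"
      by (metis append_take_drop_id le_sup_iff set_append set_subset_Cons subset_trans)
    then show ?thesis
      using * sub adm_insertD[OF *(2) r(2)] plen_insert[OF r(2), of x v]
      by (auto simp: v tlen_eq btw_def)
  qed
  have "del_at (Suc i) xs = x # r \<longleftrightarrow> (\<exists>v. xs = x # take i r @ v # drop i r)"
  proof
    assume *: "del_at (Suc i) xs = x # r"
    obtain y t where t: "xs = y # t" "length t = Suc (length r)"
      using xs r(1) by (cases xs) (auto simp: Cons_in_gens Nil_notin_gens)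
    then have "y = x" "take i r = take i t" "drop i r = drop (Suc i) t"
      using * r(2) by (auto simp: del_at_def)
    moreover have "t = take i t @ t ! i # drop (Suc i) t"
      using t(2) r(2) by (intro id_take_nth_drop) auto
    ultimately show "\<exists>v. xs = x # take i r @ v # drop i r"
      using t(1) by metis
  next
    assume "\<exists>v. xs = x # take i r @ v # drop i r"
    then show "del_at (Suc i) xs = x # r"
      using r(2) by (auto simp: del_at_def)
  qed
  then show ?thesis
    using iff by auto
qed

text \<open>The differential never deletes the starting vertex, so it acts separately for each
  \<open>x\<close>. If \<open>k\<close> does not fit the length of \<open>r\<close>, both sides
  vanish.\<close>

lemma mbd_Cons:
  assumes c: "is_chain V E k l c"
  shows "mbd V E k l c (x # r) = bdry x (\<lambda>t. c (x # t)) r"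
proof (cases "k = Suc (length r)")
  case False
  have "bdry x (\<lambda>t. c (x # t)) r = 0"
  proof (rule ccontr)
    assume "bdry x (\<lambda>t. c (x # t)) r \<noteq> 0"
    then obtain r' where "c (x # r') \<noteq> 0" "length r' = Suc (length r)"
      by (rule bdry_nonzeroE)
    then show False
      using c False unfolding is_chain_def by (metis Cons_in_gens)
  qed
  moreover have "del_at i xs \<noteq> x # r" if "xs \<in> gens V E k l" "i \<in> {1..k-1}" for i xs
  proof -
    have "length (del_at i xs) = k"
      using that by (auto simp: del_at_def gens_def)
    then show ?thesis
      using False by auto
  qed
  ultimately show ?thesis
    by (auto simp: mbd_def intro!: sum.neutral)
next
  case True
  have inner: "(\<Sum>xs\<in>gens V E k l. c xs *
      (if tlen V E (del_at (Suc i) xs) = tlen V E xs \<and> del_at (Suc i) xs = x # r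
       then (-1) ^ Suc i else 0))
    = (-1) ^ Suc i * (\<Sum>v\<in>btw ((x # r) ! i) (r ! i). c (x # take i r @ v # drop i r))"
    if i: "i < length r" for i
  proof -
    let ?f = "\<lambda>v. x # take i r @ v # drop i r"
    let ?B = "?f ` btw ((x # r) ! i) (r ! i)"
    \<comment> \<open>Generators outside \<open>?B\<close> do not map to \<open>x # r\<close>, and
      tuples in \<open>?B\<close> that are no generators have coefficient 0 because \<open>c\<close>
      is a chain.\<close>
    have "(\<Sum>xs\<in>gens V E k l. c xs *
      (if tlen V E (del_at (Suc i) xs) = tlen V E xs \<and> del_at (Suc i) xs = x # r
       then (-1) ^ Suc i else 0)) = (\<Sum>xs\<in>?B. (-1) ^ Suc i * c xs)"
    proof (rule sum.mono_neutral_cong)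
      fix xs assume "xs \<in> ?B - gens V E k l"
      then show "(-1) ^ Suc i * c xs = 0"
        using c by (auto simp: is_chain_def)
    qed (use del_at_eq_iff[OF _ True i, of _ l x] in \<open>auto simp: finite_gens\<close>)
    also have "\<dots> = (\<Sum>v\<in>btw ((x # r) ! i) (r ! i). (-1) ^ Suc i * c (?f v))"
      by (subst sum.reindex) (auto simp: inj_on_def)
    finally show ?thesis
      by (simp add: sum_distrib_left)
  qed
  have "mbd V E k l c (x # r) = (\<Sum>i<length r. \<Sum>xs\<in>gens V E k l. c xs *
      (if tlen V E (del_at (Suc i) xs) = tlen V E xs \<and> del_at (Suc i) xs = x # r
       then (-1) ^ Suc i else 0))"
    unfolding mbd_def sum_distrib_left
    by (subst sum.swap) (simp add: True sum.atLeast1_atMost_eq)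
  then show ?thesis
    by (simp add: bdry_eq_sum inner)
qed

lemma mbd_Nil: "mbd V E k l c [] = 0"
proof -
  have "del_at i xs \<noteq> []" if "xs \<in> gens V E k l" "i \<in> {1..k-1}" for i xs
    using that by (auto simp: del_at_def gens_def)
  then show ?thesis
    by (auto simp: mbd_def intro!: sum.neutral)
qed

text \<open>The complex splits by starting vertex, and the summand at \<open>x\<close> is, off the
  diagonal, the complex of the full ideal \<open>V - {x}\<close>. The chains bounding the summands
  are glued.\<close>

theorem diagonal_if_koszul_filtration:
  assumes F: "koszul_filtration F" and F_full: "\<And>x. x \<in> V \<Longrightarrow> F x (V - {x})"
  shows "diagonal V E"
  unfolding diagonal_def MH_vanishes_def
proof (intro allI impI, elim conjE)
  fix k l :: nat and c
  assume kl: "k \<noteq> l" and c: "is_chain V E k l c" and bdry_c: "mbd V E k l c = (\<lambda>_. 0)"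
  have "\<exists>b. chain_in x (V - {x}) (Suc k) l b \<and> bdry x b = (\<lambda>t. c (x # t))" if "x \<in> V" for x
  proof (rule exact_off_diagonal[OF F F_full[OF that] kl])
    show "chain_in x (V - {x}) k l (\<lambda>t. c (x # t))"
      unfolding chain_in_def
    proof (intro allI impI)
      fix t assume "c (x # t) \<noteq> 0"
      then have t: "adm x t" "length t = k" "plen x t = l"
        using c unfolding is_chain_def by (metis Cons_in_gens)+
      \<comment> \<open>An empty \<open>t\<close> has degree and length 0, which
        \<open>k \<noteq> l\<close> excludes.\<close>
      then show "adm x t \<and> length t = k \<and> plen x t = l \<and> t \<noteq> [] \<and> hd t \<in> V - {x}"
        using kl by (cases t) auto
    qed
    show "bdry x (\<lambda>t. c (x # t)) r = 0" for r
      using mbd_Cons[OF c, of x r] bdry_c by simp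
  qed
  then obtain B where B: "\<And>x. x \<in> V \<Longrightarrow> chain_in x (V - {x}) (Suc k) l (B x)"
    "\<And>x. x \<in> V \<Longrightarrow> bdry x (B x) = (\<lambda>t. c (x # t))"
    by metis
  define b where "b xs = (if xs \<noteq> [] \<and> hd xs \<in> V then B (hd xs) (tl xs) else 0)" for xs
  have b: "is_chain V E (Suc k) l b"
    unfolding is_chain_def
  proof (intro allI impI)
    fix xs assume "xs \<notin> gens V E (Suc k) l"
    then show "b xs = 0"
      using B(1) by (cases xs) (auto simp: b_def Cons_in_gens chain_in_def)
  qed
  have "mbd V E (Suc k) l b xs = c xs" for xs
  proof (cases xs)
    case Nil
    then show ?thesis
      using c by (simp add: mbd_Nil is_chain_def Nil_notin_gens)
  next
    case (Cons x r)
    show ?thesis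
    proof (cases "x \<in> V")
      case True
      then show ?thesis
        by (simp add: Cons mbd_Cons[OF b] b_def B(2))
    next
      case False
      then show ?thesis
        using c by (simp add: Cons mbd_Cons[OF b] b_def is_chain_def Cons_in_gens)
    qed
  qed
  with b show "\<exists>b. is_chain V E (Suc k) l b \<and> mbd V E (Suc k) l b = c"
    by blast
qed

end

end

section \<open>The icosahedral graph\<close>

text \<open>The Lipschitz condition along edges bounds every walk from below, and following the
  descent builds a walk of length \<open>d x z\<close>.\<close>

lemma gdist_eqI:
  fixes d :: "'a \<Rightarrow> 'a \<Rightarrow> nat"
  assumes refl: "\<And>x. x \<in> V \<Longrightarrow> d x x = 0"
    and lipschitz: "\<And>x y z. \<lbrakk>x \<in> V; y \<in> V; z \<in> V; E x y\<rbrakk> \<Longrightarrow> d x z \<le> Suc (d y z)"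
    and descent: "\<And>x z. \<lbrakk>x \<in> V; z \<in> V; x \<noteq> z\<rbrakk> \<Longrightarrow> \<exists>y\<in>V. E x y \<and> d x z = Suc (d y z)"
    and "x \<in> V" "z \<in> V"
  shows "gdist V E x z = enat (d x z)"
proof -
  have lower: "d (hd p) (last p) \<le> length p - 1" if "is_walk E V p" for p
    using that
  proof (induction p)
    case Nil
    then show ?case by (simp add: is_walk_def)
  next
    case (Cons a p)
    show ?case
    proof (cases p)
      case Nil
      then show ?thesis
        using Cons.prems by (simp add: is_walk_def refl)
    next
      case (Cons b q)
      have V: "a \<in> V" "b \<in> V" "last p \<in> V" "E a b"
        using Cons.prems Cons last_in_set[of p] by (auto simp: is_walk_def)
      have "is_walk E V p"
        using Cons.prems Cons by (fastforce simp: is_walk_def)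
      then have "d b (last p) \<le> length p - 1"
        using Cons.IH Cons by simp
      then show ?thesis
        using lipschitz[OF V(1,2,3,4)] Cons by simp
    qed
  qed
  have "\<exists>p. is_walk E V p \<and> hd p = x \<and> last p = z \<and> length p - 1 = d x z"
    using \<open>x \<in> V\<close>
  proof (induction "d x z" arbitrary: x)
    case 0
    then have "x = z"
      using descent[of x z] \<open>z \<in> V\<close> by force
    then show ?case
      using 0 by (intro exI[of _ "[x]"]) (auto simp: is_walk_def)
  next
    case (Suc n)
    then have "x \<noteq> z"
      using refl by force
    then obtain y where y: "y \<in> V" "E x y" "d x z = Suc (d y z)"
      using descent Suc.prems \<open>z \<in> V\<close> by blast
    then obtain p where p: "is_walk E V p" "hd p = y" "last p = z" "length p - 1 = d y z"
      using Suc.hyps by auto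
    then have "is_walk E V (x # p)"
      using y(1,2) Suc.prems
      by (auto simp: is_walk_def nth_Cons hd_conv_nth split: nat.splits)
    then show ?case
      using p y(3) by (intro exI[of _ "x # p"]) (use p(1) in \<open>auto simp: is_walk_def neq_Nil_conv\<close>)
  qed
  then show ?thesis
    unfolding gdist_def using lower by (intro antisym Inf_lower Inf_greatest) force+
qed

section \<open>Distances in the icosahedron\<close>

definition ico_antipodes :: "(nat \<times> nat) set" where
  "ico_antipodes = {(0,11),(1,9),(2,10),(3,6),(4,7),(5,8),(11,0),(9,1),(10,2),(6,3),(7,4),(8,5)}"

text \<open>The value 2 outside \<open>ico_V\<close> makes this a metric on all of \<open>nat\<close>.\<close>
definition ico_d :: "nat \<Rightarrow> nat \<Rightarrow> nat" where
  "ico_d x y = (if x = y then 0 else if ico_E x y then 1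
     else if (x, y) \<in> ico_antipodes then 3 else 2)"

interpretation ico: finite_distance ico_V ico_d
proof
  show "finite ico_V"
    by (simp add: ico_V_def)
  fix x y z
  show "ico_d x y = 0 \<longleftrightarrow> x = y"
    by (simp add: ico_d_def)
  \<comment> \<open>The triangle inequality could fail only for antipodes, at distance 3, joined by
    two edges.\<close>
  have "\<forall>(x, z)\<in>ico_antipodes. \<forall>y\<in>ico_V. \<not> (ico_E x y \<and> ico_E y z)"
    by code_simp
  moreover have "y \<in> ico_V" if "ico_E x y"
    using that by (auto simp: ico_E_def ico_edge_list_def ico_V_def)
  ultimately show "ico_d x z \<le> ico_d x y + ico_d y z"
    by (auto simp: ico_d_def)
qed

lemma gdist_ico: "x \<in> ico_V \<Longrightarrow> z \<in> ico_V \<Longrightarrow> gdist ico_V ico_E x z = enat (ico_d x z)"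
proof (rule gdist_eqI)
  fix x y z assume "ico_E x y"
  then have "ico_d x y \<le> 1"
    by (simp add: ico_d_def)
  then show "ico_d x z \<le> Suc (ico_d y z)"
    using ico.d_triangle[of x z y] by linarith
next
  have "\<forall>x\<in>ico_V. \<forall>z\<in>ico_V. x \<noteq> z \<longrightarrow> (\<exists>y\<in>ico_V. ico_E x y \<and> ico_d x z = Suc (ico_d y z))"
    by code_simp
  then show "\<exists>y\<in>ico_V. ico_E x y \<and> ico_d x z = Suc (ico_d y z)"
    if "x \<in> ico_V" "z \<in> ico_V" "x \<noteq> z" for x z
    using that by blast
qed (auto simp: ico_d_def)

section \<open>Rotations and vertex transitivity\<close>

text \<open>The rotations about the vertex 0 and about the face \<open>{0, 1, 2}\<close>.\<close>

definition ico_vrot :: "nat \<Rightarrow> nat" where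
  "ico_vrot x = [0, 2, 3, 4, 5, 1, 7, 8, 9, 10, 6, 11] ! x"

definition ico_frot :: "nat \<Rightarrow> nat" where
  "ico_frot x = [1, 2, 0, 5, 6, 7, 8, 3, 4, 10, 11, 9] ! x"

lemma isometry_vrot: "ico.isometry ico_vrot"
proof -
  have "ico_vrot ` ico_V = ico_V"
    by code_simp
  moreover have "\<forall>x\<in>ico_V. \<forall>y\<in>ico_V. ico_d (ico_vrot x) (ico_vrot y) = ico_d x y"
    by code_simp
  ultimately show ?thesis
    by (simp add: ico.isometry_def)
qed

lemma isometry_frot: "ico.isometry ico_frot"
proof -
  have "ico_frot ` ico_V = ico_V"
    by code_simp
  moreover have "\<forall>x\<in>ico_V. \<forall>y\<in>ico_V. ico_d (ico_frot x) (ico_frot y) = ico_d x y"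
    by code_simp
  ultimately show ?thesis
    by (simp add: ico.isometry_def)
qed

text \<open>For \<open>j < 5\<close> this rotation takes 0 to its neighbour \<open>j + 1\<close>,
  the generator that is added to \<open>ico_arc j\<close>.\<close>

lemma isometry_vrot_pow_frot: "ico.isometry ((ico_vrot ^^ j) \<circ> ico_frot)"
proof -
  have "ico.isometry (ico_vrot ^^ j)"
  proof (induction j)
    case 0
    then show ?case
      using ico.isometry_id by (simp add: id_def)
  next
    case (Suc j)
    then show ?case
      using ico.isometry_comp[OF isometry_vrot] by (simp only: funpow.simps)
  qed
  then show ?thesis
    by (rule ico.isometry_comp) (rule isometry_frot)
qed

text \<open>The orbit of 0 is exhausted by turning each pentagon with \<open>ico_vrot\<close> and
  passing between layers with \<open>ico_frot\<close>.\<close>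

lemma ico_vertex_transitive:
  assumes "x \<in> ico_V"
  shows "\<exists>g. ico.isometry g \<and> g 0 = x"
proof -
  define R where "R = {g 0 | g. ico.isometry g}"
  have R_0: "0 \<in> R"
    unfolding R_def using ico.isometry_id by (intro CollectI exI[of _ id]) simp
  have closed: "f x \<in> R" if "ico.isometry f" "x \<in> R" for f x
  proof -
    obtain g where "ico.isometry g" "x = g 0"
      using \<open>x \<in> R\<close> by (auto simp: R_def)
    then have "ico.isometry (f \<circ> g)" "f x = (f \<circ> g) 0"
      using ico.isometry_comp[OF \<open>ico.isometry f\<close>] by auto
    then show ?thesis
      unfolding R_def by blast
  qed
  note vrot = closed[OF isometry_vrot] and frot = closed[OF isometry_frot]
  have 1: "1 \<in> R"
    using frot[OF R_0] by (simp add: ico_frot_def)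
  have 2: "2 \<in> R" using vrot[OF 1] by (simp add: ico_vrot_def)
  have 3: "3 \<in> R" using vrot[OF 2] by (simp add: ico_vrot_def)
  have 4: "4 \<in> R" using vrot[OF 3] by (simp add: ico_vrot_def)
  have 5: "5 \<in> R" using vrot[OF 4] by (simp add: ico_vrot_def)
  have 7: "7 \<in> R" using frot[OF 5] by (simp add: ico_frot_def)
  have 8: "8 \<in> R" using vrot[OF 7] by (simp add: ico_vrot_def)
  have 9: "9 \<in> R" using vrot[OF 8] by (simp add: ico_vrot_def)
  have 10: "10 \<in> R" using vrot[OF 9] by (simp add: ico_vrot_def)
  have 6: "6 \<in> R" using vrot[OF 10] by (simp add: ico_vrot_def)
  have 11: "11 \<in> R" using frot[OF 10] by (simp add: ico_frot_def)
  have "ico_V = {0, 1, 2, 3, 4, 5, 6, 7, 8, 9, 10, 11}"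
    by code_simp
  then have "ico_V \<subseteq> R"
    by (elim ssubst) (intro insert_subset[THEN iffD2] conjI empty_subsetI R_0 1 2 3 4 5 6 7 8 9 10 11)
  then have "x \<in> R"
    using assms by (rule subsetD)
  then show ?thesis
    by (auto simp: R_def)
qed

section \<open>The Koszul filtration at the vertex 0\<close>

text \<open>The ideal at the vertex 0 that is generated by its first \<open>j\<close> neighbours.\<close>
definition ico_arc :: "nat \<Rightarrow> nat set" where
  "ico_arc j = [{}, {1,6,7,11}, {1,2,6,7,8,11}, {1,2,3,6,7,8,9,11}, {1,2,3,4,6,7,8,9,10,11},
     {1,2,3,4,5,6,7,8,9,10,11}] ! j"

lemma ico_arc_subset: "j \<le> 5 \<Longrightarrow> ico_arc j \<subseteq> ico_V"
proof -
  have "\<forall>j\<in>{..5}. ico_arc j \<subseteq> ico_V"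
    by code_simp
  then show "j \<le> 5 \<Longrightarrow> ico_arc j \<subseteq> ico_V"
    by simp
qed

lemma closed_from_ico_arc: "j \<le> 5 \<Longrightarrow> ico.closed_from 0 (ico_arc j)"
proof -
  have "\<forall>j\<in>{..5}. \<forall>z\<in>ico_V - ico_arc j. \<forall>y\<in>ico_arc j. ico_d 0 y + ico_d y z \<noteq> ico_d 0 z"
    by code_simp
  then show "j \<le> 5 \<Longrightarrow> ico.closed_from 0 (ico_arc j)"
    unfolding ico.closed_from_def ico.btw_def by blast
qed

text \<open>The list counts the generators of the colon ideal at \<open>j + 1\<close>, that is, its
  neighbours that are not newly added: the first step adds two lower neighbours, the middle ones add
  one each, and the last adds none.\<close>

lemma ico_arc_step:
  assumes "j < 5"
  defines "f \<equiv> (ico_vrot ^^ j) \<circ> ico_frot"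
  shows "[3,4,4,4,5] ! j \<le> (5::nat) \<and> ico_arc j \<subseteq> ico_arc (Suc j) \<and>
    f 0 \<in> ico_arc (Suc j) - ico_arc j \<and> ico_d 0 (f 0) = 1 \<and>
    (\<forall>y\<in>ico_arc (Suc j) - ico_arc j. ico_d 0 (f 0) + ico_d (f 0) y = ico_d 0 y) \<and>
    ico_V - {f 0} - (ico_arc (Suc j) - ico_arc j) = f ` ico_arc ([3,4,4,4,5] ! j)"
proof -
  have all: "\<forall>j\<in>{..<5}. let f = (ico_vrot ^^ j) \<circ> ico_frot; U = ico_arc (Suc j); U' = ico_arc j in
    [3,4,4,4,5] ! j \<le> (5::nat) \<and> U' \<subseteq> U \<and> f 0 \<in> U - U' \<and> ico_d 0 (f 0) = 1 \<and>
    (\<forall>y\<in>U - U'. ico_d 0 (f 0) + ico_d (f 0) y = ico_d 0 y) \<and>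
    ico_V - {f 0} - (U - U') = f ` ico_arc ([3,4,4,4,5] ! j)"
    by code_simp
  show ?thesis
    unfolding f_def
    by (rule bspec[OF all[unfolded Let_def] lessThan_iff[THEN iffD2, OF assms(1)]])
qed

theorem theorem3p4:
  shows "diagonal ico_V ico_E"
proof (rule ico.diagonal_if_koszul_filtration)
  show "gdist ico_V ico_E x y = enat (ico_d x y)" if "x \<in> ico_V" "y \<in> ico_V" for x y
    using that by (rule gdist_ico)
  let ?F = "\<lambda>x U. \<exists>g j. ico.isometry g \<and> j \<le> 5 \<and> x = g 0 \<and> U = g ` ico_arc j"
  show "ico.koszul_filtration ?F"
  proof (rule ico.koszul_filtration_translates)
    show "0 \<in> ico_V"
      by (simp add: ico_V_def)
    show "ico_arc 0 = {}"
      by (simp add: ico_arc_def)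
    show "ico_arc j \<subseteq> ico_V \<and> ico.closed_from 0 (ico_arc j)" if "j \<le> 5" for j
      using that by (intro conjI ico_arc_subset closed_from_ico_arc)
    fix j :: nat assume "j < 5"
    then show "\<exists>f m. ico.isometry f \<and> m \<le> 5 \<and> ico_arc j \<subseteq> ico_arc (Suc j) \<and>
      f 0 \<in> ico_arc (Suc j) - ico_arc j \<and> ico_d 0 (f 0) = 1 \<and>
      (\<forall>y\<in>ico_arc (Suc j) - ico_arc j. ico_d 0 (f 0) + ico_d (f 0) y = ico_d 0 y) \<and>
      ico_V - {f 0} - (ico_arc (Suc j) - ico_arc j) = f ` ico_arc m"
      using isometry_vrot_pow_frot[of j] ico_arc_step[of j] by blast
  qed
  show "?F x (ico_V - {x})" if x: "x \<in> ico_V" for x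
  proof -
    obtain g where g: "ico.isometry g" "g 0 = x"
      using ico_vertex_transitive[OF x] by blast
    \<comment> \<open>The full ideal at \<open>x\<close> is the translate of the one generated by
      all five neighbours of 0.\<close>
    have "ico_arc 5 = ico_V - {0}"
      by code_simp
    then have "g ` ico_arc 5 = ico_V - {x}"
      using ico.isometry_image_Diff[OF g(1), of ico_V "{0}"] g
      by (simp add: ico.isometry_def) (simp add: ico_V_def)
    then show ?thesis
      using g by (intro exI[of _ g] exI[of _ 5]) auto
  qed
qed

end
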